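(* For every finite simple connected graph $G$ with at least two vertices, $\gamma_{\mathrm{os}}(\mathscr{P}_3(G))=\gamma_{R}(G)$.
   Context: For a poset $P=(X,\le)$, $\mathrm{Mid}(P)$ is the set of elements that are neither maximal nor minimal. The comparability graph $\mathrm{Comp}(P)$ has vertex set $X$, with $x\neq y$ adjacent iff $x<y$ or $y<x$. A dominating set of a graph is a set $S$ of vertices such that every vertex not in $S$ has a neighbor in $S$. An order-sensitive dominating set of $P$ is a dominating set $D$ of $\mathrm{Comp}(P)$ such that for every $x\in\mathrm{Mid}(P)$, either $x\in D$ or there are $a,b\in D$ with $a<x<b$. $\gamma_{\mathrm{os}}(P)$ is the minimum size of an order-sensitive dominating set of $P$. For a graph $G$ on vertex set $[n]=\{1,\dots,n\}$ and an integer $k\ge 2$, $\mathscr{P}_k(G)$ is the graded poset with ground set $\{x_{(l,i)} : l\in[k],\ i\in[n]\}$ whose covering relations are: for $r\in[k-1]$ and $i,j\in[n]$, $x_{(r,i)}\prec x_{(r+1,j)}$ iff $i=j$ or $ij\in E(G)$. A Roman dominating function of $G$ is a function $f:V(G)\to\{0,1,2\}$ such that every vertex $v$ with $f(v)=0$ has a neighbor $u$ with $f(u)=2$; its weight is $\sum_{v}f(v)$. The Roman domination number $\gamma_R(G)$ is the minimum weight of a Roman dominating function of $G$. *)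

theory Defs
  imports "Graph_Theory.Digraph_Component"
begin

text \<open>
  A poset is given by its ground set \<open>X\<close> and a reflexive order relation \<open>r\<close>
  with \<^prop>\<open>partial_order_on X r\<close>. Finite simple graphs are those of the locale
  \<open>graph\<close>: finite symmetric digraphs without loops and parallel arcs, so that
  \<open>u \<rightarrow>\<^bsub>G\<^esub> v\<close> is adjacency.
\<close>

definition strict_rel :: "'a rel \<Rightarrow> 'a rel" where
  "strict_rel r = r - Id"

definition minimal_elts :: "'a set \<Rightarrow> 'a rel \<Rightarrow> 'a set" where
  "minimal_elts X r = {x \<in> X. \<nexists>y. y \<in> X \<and> (y, x) \<in> strict_rel r}"

definition maximal_elts :: "'a set \<Rightarrow> 'a rel \<Rightarrow> 'a set" where
  "maximal_elts X r = {x \<in> X. \<nexists>y. y \<in> X \<and> (x, y) \<in> strict_rel r}"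

definition Mid :: "'a set \<Rightarrow> 'a rel \<Rightarrow> 'a set" where
  "Mid X r = {x \<in> X. x \<notin> maximal_elts X r \<and> x \<notin> minimal_elts X r}"

definition covering_rel :: "'a set \<Rightarrow> 'a rel \<Rightarrow> 'a rel" where
  "covering_rel X r = {(x, y). x \<in> X \<and> y \<in> X \<and> (x, y) \<in> strict_rel r \<and>
     (\<nexists>z. z \<in> X \<and> (x, z) \<in> strict_rel r \<and> (z, y) \<in> strict_rel r)}"

definition Comp :: "'a set \<Rightarrow> 'a rel \<Rightarrow> 'a pair_pre_digraph" where
  "Comp X r = \<lparr>pverts = X,
     parcs = {(x, y). x \<in> X \<and> y \<in> X \<and> ((x, y) \<in> strict_rel r \<or> (y, x) \<in> strict_rel r)}\<rparr>"

definition dominating_set :: "('a, 'b) pre_digraph \<Rightarrow> 'a set \<Rightarrow> bool" where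
  "dominating_set G S \<longleftrightarrow>
     S \<subseteq> verts G \<and> (\<forall>v \<in> verts G. v \<notin> S \<longrightarrow> (\<exists>u \<in> S. v \<rightarrow>\<^bsub>G\<^esub> u))"

definition os_dominating_set :: "'a set \<Rightarrow> 'a rel \<Rightarrow> 'a set \<Rightarrow> bool" where
  "os_dominating_set X r D \<longleftrightarrow>
     dominating_set (with_proj (Comp X r)) D \<and>
     (\<forall>x \<in> Mid X r. x \<in> D \<or> (\<exists>a \<in> D. \<exists>b \<in> D. (a, x) \<in> strict_rel r \<and> (x, b) \<in> strict_rel r))"

definition gamma_os :: "'a set \<Rightarrow> 'a rel \<Rightarrow> nat" where
  "gamma_os X r = (LEAST m. \<exists>D. finite D \<and> os_dominating_set X r D \<and> card D = m)"

text \<open>The pair \<open>(l, i)\<close> is the element of the poset at level \<open>l\<close> over the vertex \<open>i\<close>.\<close>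

definition layer_elts :: "nat \<Rightarrow> ('a, 'b) pre_digraph \<Rightarrow> (nat \<times> 'a) set" where
  "layer_elts k G = {1..k} \<times> verts G"

definition layer_covers :: "nat \<Rightarrow> ('a, 'b) pre_digraph \<Rightarrow> (nat \<times> 'a) rel" where
  "layer_covers k G = {((l, i), (Suc l, j)) | l i j.
     l \<in> {1..k - 1} \<and> i \<in> verts G \<and> j \<in> verts G \<and> (i = j \<or> i \<rightarrow>\<^bsub>G\<^esub> j)}"

definition layer_order :: "nat \<Rightarrow> ('a, 'b) pre_digraph \<Rightarrow> (nat \<times> 'a) rel" where
  "layer_order k G = Id_on (layer_elts k G) \<union> (layer_covers k G)\<^sup>+"

lemma layer_covers_subset: "layer_covers k G \<subseteq> layer_elts k G \<times> layer_elts k G"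
  by (auto simp: layer_covers_def layer_elts_def)

lemma trancl_layer_covers_level:
  "(x, y) \<in> (layer_covers k G)\<^sup>+ \<Longrightarrow> fst x < fst y"
  by (induction rule: trancl_induct) (auto simp: layer_covers_def)

lemma strict_layer_order: "strict_rel (layer_order k G) = (layer_covers k G)\<^sup>+"
  using trancl_layer_covers_level by (fastforce simp: strict_rel_def layer_order_def)

lemma partial_order_on_layer_order: "partial_order_on (layer_elts k G) (layer_order k G)"
proof -
  have "(layer_covers k G)\<^sup>+ \<subseteq> layer_elts k G \<times> layer_elts k G"
    using trancl_subset_Sigma[OF layer_covers_subset] .
  moreover have "\<not> ((x, y) \<in> (layer_covers k G)\<^sup>+ \<and> (y, x) \<in> (layer_covers k G)\<^sup>+)" for x y
    using trancl_layer_covers_level[of x y k G] trancl_layer_covers_level[of y x k G] by auto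
  ultimately show ?thesis
    unfolding partial_order_on_def preorder_on_def layer_order_def
    by (auto simp: refl_on_def intro!: transI antisymI intro: trancl_trans)
qed

lemma covering_rel_layer_order:
  "covering_rel (layer_elts k G) (layer_order k G) = layer_covers k G"
proof (rule set_eqI, rule iffI)
  fix p assume p: "p \<in> covering_rel (layer_elts k G) (layer_order k G)"
  obtain x y where xy: "p = (x, y)" by (cases p)
  from p have t: "(x, y) \<in> (layer_covers k G)\<^sup>+"
    and n: "\<And>z. z \<in> layer_elts k G \<Longrightarrow> (x, z) \<in> (layer_covers k G)\<^sup>+ \<Longrightarrow>
              (z, y) \<notin> (layer_covers k G)\<^sup>+"
    by (auto simp: xy covering_rel_def strict_layer_order)
  from t show "p \<in> layer_covers k G"
  proof (cases rule: tranclE)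
    case base
    then show ?thesis by (simp add: xy)
  next
    case (step z)
    then have "z \<in> layer_elts k G" using layer_covers_subset[of k G] by auto
    with n[of z] step show ?thesis by auto
  qed
next
  fix p assume p: "p \<in> layer_covers k G"
  then obtain x y where xy: "p = (x, y)" and l: "fst y = Suc (fst x)"
    by (auto simp: layer_covers_def)
  have "\<not> ((x, z) \<in> (layer_covers k G)\<^sup>+ \<and> (z, y) \<in> (layer_covers k G)\<^sup>+)" for z
    using trancl_layer_covers_level[of x z k G] trancl_layer_covers_level[of z y k G] l by auto
  then show "p \<in> covering_rel (layer_elts k G) (layer_order k G)"
    using p xy layer_covers_subset[of k G]
    by (auto simp: covering_rel_def strict_layer_order)
qed

definition roman_dominating :: "('a, 'b) pre_digraph \<Rightarrow> ('a \<Rightarrow> nat) \<Rightarrow> bool" where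
  "roman_dominating G f \<longleftrightarrow>
     (\<forall>v \<in> verts G. f v \<in> {0, 1, 2}) \<and>
     (\<forall>v \<in> verts G. f v = 0 \<longrightarrow> (\<exists>u \<in> verts G. v \<rightarrow>\<^bsub>G\<^esub> u \<and> f u = 2))"

definition gamma_R :: "('a, 'b) pre_digraph \<Rightarrow> nat" where
  "gamma_R G = (LEAST m. \<exists>f. roman_dominating G f \<and> (\<Sum>v \<in> verts G. f v) = m)"

end

theory Submission
  imports Defs
begin

text \<open>
  A Roman dominating function \<open>f\<close> yields an order-sensitive dominating set of the same size: take
  the middle copy of each vertex of value \<open>1\<close> and both outer copies of each vertex of value \<open>2\<close>.
  Conversely, if \<open>A\<close>, \<open>B\<close>, \<open>C\<close> are the layers of an order-sensitive dominating set, then every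
  vertex outside \<open>B\<close> has both \<open>A\<close> and \<open>C\<close> in its closed neighbourhood. So giving \<open>2\<close> to the smaller
  of \<open>A\<close> and \<open>C\<close> and \<open>1\<close> to the rest of \<open>B\<close> is Roman dominating, of weight at most
  \<open>2 min(|A|, |C|) + |B| \<le> |A| + |B| + |C|\<close>.
\<close>

text \<open>Each direction only has to produce a value no larger than the given one, so the
  translations may lose weight. The assumption \<open>P m\<close> matters because
  \<open>LEAST\<close> says nothing about a predicate that never holds.\<close>

lemma Least_nat_eqI:
  fixes P Q :: "nat \<Rightarrow> bool"
  assumes "P m" and "\<And>m. P m \<Longrightarrow> \<exists>n\<le>m. Q n" and "\<And>n. Q n \<Longrightarrow> \<exists>m\<le>n. P m"
  shows "(LEAST m. P m) = (LEAST n. Q n)"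
proof (rule antisym)
  obtain n where "Q n" using assms(1,2) by blast
  then have "Q (LEAST n. Q n)" by (rule LeastI)
  then show "(LEAST m. P m) \<le> (LEAST n. Q n)"
    using assms(3) by (meson Least_le order_trans)
  have "P (LEAST m. P m)" using assms(1) by (rule LeastI)
  then show "(LEAST n. Q n) \<le> (LEAST m. P m)"
    using assms(2) by (meson Least_le order_trans)
qed

lemma dominates_Comp_iff:
  "x \<rightarrow>\<^bsub>with_proj (Comp X r)\<^esub> y \<longleftrightarrow>
     x \<in> X \<and> y \<in> X \<and> ((x, y) \<in> strict_rel r \<or> (y, x) \<in> strict_rel r)"
  by (auto simp: arcs_ends_def arc_to_ends_def Comp_def)

lemma strict_layer_order_coverI:
  assumes "1 \<le> l" "l < k" "i \<in> verts G" "j \<in> verts G" "i = j \<or> i \<rightarrow>\<^bsub>G\<^esub> j"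
  shows "((l, i), (Suc l, j)) \<in> strict_rel (layer_order k G)"
  unfolding strict_layer_order using assms by (intro r_into_trancl) (auto simp: layer_covers_def)

text \<open>Every cover raises the level, so a chain between consecutive levels has no room for an
  intermediate element and is a single cover.\<close>

lemma strict_layer_order_SucD:
  assumes "((l, i), (Suc l, j)) \<in> strict_rel (layer_order k G)"
  shows "i \<in> verts G \<and> j \<in> verts G \<and> (i = j \<or> i \<rightarrow>\<^bsub>G\<^esub> j)"
proof -
  from assms have "((l, i), (Suc l, j)) \<in> (layer_covers k G)\<^sup>+"
    by (simp add: strict_layer_order)
  then show ?thesis
  proof (cases rule: tranclE)
    case base
    then show ?thesis by (auto simp: layer_covers_def)
  next
    case (step z)
    then have "l < fst z" "fst z < Suc l"
      using trancl_layer_covers_level[OF step(1)] trancl_layer_covers_level[OF r_into_trancl[OF step(2)]]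
      by auto
    then show ?thesis by simp
  qed
qed

lemma strict_layer_order_trans:
  "(x, y) \<in> strict_rel (layer_order k G) \<Longrightarrow> (y, z) \<in> strict_rel (layer_order k G) \<Longrightarrow>
    (x, z) \<in> strict_rel (layer_order k G)"
  unfolding strict_layer_order by (rule trancl_trans)

lemma strict_layer_order_level:
  "(x, y) \<in> strict_rel (layer_order k G) \<Longrightarrow> fst x < fst y"
  unfolding strict_layer_order by (rule trancl_layer_covers_level)

text \<open>The covers with \<open>i = j\<close> put every \<open>(2, i)\<close> strictly between
  \<open>(1, i)\<close> and \<open>(3, i)\<close>; conversely, an element with something below and
  above it in levels 1 to 3 has level 2.\<close>

lemma Mid_layer_order_3: "Mid (layer_elts 3 G) (layer_order 3 G) = {2} \<times> verts G"
proof -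
  have "(l, i) \<in> Mid (layer_elts 3 G) (layer_order 3 G) \<longleftrightarrow> l = 2 \<and> i \<in> verts G" for l i
  proof
    assume "(l, i) \<in> Mid (layer_elts 3 G) (layer_order 3 G)"
    then obtain x y where "i \<in> verts G" "x \<in> layer_elts 3 G" "y \<in> layer_elts 3 G"
        "(x, (l, i)) \<in> strict_rel (layer_order 3 G)" "((l, i), y) \<in> strict_rel (layer_order 3 G)"
      by (auto simp: Mid_def minimal_elts_def maximal_elts_def layer_elts_def)
    then show "l = 2 \<and> i \<in> verts G"
      using strict_layer_order_level[of x "(l, i)" 3 G] strict_layer_order_level[of "(l, i)" y 3 G]
      by (auto simp: layer_elts_def)
  next
    assume li: "l = 2 \<and> i \<in> verts G"
    have "((1, i), (2, i)) \<in> strict_rel (layer_order 3 G)"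
         "((2, i), (3, i)) \<in> strict_rel (layer_order 3 G)"
      using strict_layer_order_coverI[of 1 3 i G i] strict_layer_order_coverI[of 2 3 i G i] li
      by (auto simp: eval_nat_numeral)
    then show "(l, i) \<in> Mid (layer_elts 3 G) (layer_order 3 G)"
      using li unfolding Mid_def minimal_elts_def maximal_elts_def layer_elts_def by fastforce
  qed
  then show ?thesis by auto
qed

text \<open>If \<open>u\<close> has value 2 and is equal or adjacent to \<open>v\<close>, its two
  outer copies enclose \<open>(2, v)\<close>, and each is comparable to the copy of \<open>v\<close>
  at the opposite end.\<close>

lemma os_dominating_set_of_roman:
  assumes "graph G" and f: "roman_dominating G f"
  shows "\<exists>D. finite D \<and> os_dominating_set (layer_elts 3 G) (layer_order 3 G) D \<and>
    card D = (\<Sum>v \<in> verts G. f v)"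
proof -
  interpret graph G by fact
  define S where "S = strict_rel (layer_order 3 G)"
  define V where "V c = {v \<in> verts G. f v = c}" for c
  define D :: "(nat \<times> _) set" where "D = {2} \<times> V 1 \<union> {1, 3} \<times> V 2"
  have S12: "((1, i), (2, j)) \<in> S" and S23: "((2, i), (3, j)) \<in> S"
    if "i \<in> verts G" "j \<in> verts G" "i = j \<or> i \<rightarrow>\<^bsub>G\<^esub> j" for i j
    using strict_layer_order_coverI[of 1 3 i G j] strict_layer_order_coverI[of 2 3 i G j] that
    by (auto simp: eval_nat_numeral S_def)
  \<comment> \<open>The chain passes through \<open>(2, j)\<close>, moving to \<open>j\<close> first
    and then going straight up.\<close>
  have S13: "((1, i), (3, j)) \<in> S"
    if "i \<in> verts G" "j \<in> verts G" "i = j \<or> i \<rightarrow>\<^bsub>G\<^esub> j" for i j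
    using strict_layer_order_trans S12[OF that] S23[of j j] that unfolding S_def by blast
  \<comment> \<open>Both directions of adjacency are recorded because \<open>u\<close> is used below
    \<open>v\<close> as well as above it.\<close>
  have near: "v \<in> V 1 \<or> (\<exists>u \<in> V 2. v = u \<or> v \<rightarrow>\<^bsub>G\<^esub> u \<and> u \<rightarrow>\<^bsub>G\<^esub> v)" if "v \<in> verts G" for v
  proof -
    consider "f v = 0" | "f v = 1" | "f v = 2"
      using f \<open>v \<in> verts G\<close> by (auto simp: roman_dominating_def)
    then show ?thesis
    proof cases
      case 1
      then obtain u where "u \<in> V 2" "v \<rightarrow>\<^bsub>G\<^esub> u"
        using f \<open>v \<in> verts G\<close> by (auto simp: roman_dominating_def V_def)
      then show ?thesis using arcs_ends_symmetric[OF sym_arcs] by blast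
    qed (use \<open>v \<in> verts G\<close> in \<open>auto simp: V_def\<close>)
  qed
  have V_verts: "v \<in> V c \<Longrightarrow> v \<in> verts G" for v c by (simp add: V_def)
  have fin: "finite (V c)" for c by (simp add: V_def)
  have sub: "D \<subseteq> layer_elts 3 G" by (auto simp: D_def V_def layer_elts_def)
  have mid: "(2, v) \<in> D \<or> (\<exists>a \<in> D. \<exists>b \<in> D. (a, (2, v)) \<in> S \<and> ((2, v), b) \<in> S)"
    if v: "v \<in> verts G" for v
  proof (cases "v \<in> V 1")
    case False
    then obtain u where u: "u \<in> V 2" "v = u \<or> v \<rightarrow>\<^bsub>G\<^esub> u \<and> u \<rightarrow>\<^bsub>G\<^esub> v"
      using near[OF v] by auto
    then have "(1, u) \<in> D" "(3, u) \<in> D" "((1, u), (2, v)) \<in> S" "((2, v), (3, u)) \<in> S"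
      using S12[of u v] S23[of v u] v V_verts by (auto simp: D_def)
    then show ?thesis by blast
  qed (simp add: D_def)
  have dom: "\<exists>y \<in> D. (x, y) \<in> S \<or> (y, x) \<in> S" if x: "x \<in> layer_elts 3 G" "x \<notin> D" for x
  proof -
    obtain l v where lv: "x = (l, v)" "v \<in> verts G" "l \<in> {1..3}"
      using x by (auto simp: layer_elts_def)
    then have l: "l = 1 \<or> l = 2 \<or> l = 3" by auto
    show ?thesis
    proof (cases "l = 2")
      case True
      then show ?thesis using mid[OF lv(2)] x(2) lv(1) by blast
    next
      case False
      show ?thesis
      proof (cases "v \<in> V 1")
        case True
        \<comment> \<open>For a vertex of value 1, the middle copy is comparable to both outer
          copies.\<close>
        then have "(2, v) \<in> D" by (simp add: D_def)
        moreover have "(x, (2, v)) \<in> S \<or> ((2, v), x) \<in> S"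
          using S12[of v v] S23[of v v] lv l \<open>l \<noteq> 2\<close> by fastforce
        ultimately show ?thesis by blast
      next
        case v: False
        then obtain u where u: "u \<in> V 2" "v = u \<or> v \<rightarrow>\<^bsub>G\<^esub> u \<and> u \<rightarrow>\<^bsub>G\<^esub> v"
          using near[OF lv(2)] by auto
        \<comment> \<open>Elements of one level are incomparable, so \<open>(3, u)\<close> serves
          \<open>x\<close> on level 1 and \<open>(1, u)\<close> serves \<open>x\<close> on level
          3.\<close>
        then have "(1, u) \<in> D" "(3, u) \<in> D" "((1, u), (3, v)) \<in> S" "((1, v), (3, u)) \<in> S"
          using S13[of u v] S13[of v u] lv V_verts by (auto simp: D_def)
        moreover from this have "(x, (1, u)) \<in> S \<or> ((1, u), x) \<in> S \<or> (x, (3, u)) \<in> S \<or> ((3, u), x) \<in> S"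
          using lv l False by fastforce
        ultimately show ?thesis by blast
      qed
    qed
  qed
  have "os_dominating_set (layer_elts 3 G) (layer_order 3 G) D"
    unfolding os_dominating_set_def dominating_set_def Mid_layer_order_3 dominates_Comp_iff
      S_def[symmetric]
  proof (intro conjI ballI impI)
    show "D \<subseteq> verts (with_proj (Comp (layer_elts 3 G) (layer_order 3 G)))"
      using sub by (simp add: Comp_def)
  next
    fix x assume "x \<in> verts (with_proj (Comp (layer_elts 3 G) (layer_order 3 G)))" "x \<notin> D"
    then have x: "x \<in> layer_elts 3 G" "x \<notin> D" by (simp_all add: Comp_def)
    obtain y where y: "y \<in> D" "(x, y) \<in> S \<or> (y, x) \<in> S" using dom[OF x] by (elim bexE)
    then show "\<exists>u \<in> D. x \<in> layer_elts 3 G \<and> u \<in> layer_elts 3 G \<and> ((x, u) \<in> S \<or> (u, x) \<in> S)"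
      using x(1) subsetD[OF sub y(1)] by (intro bexI[of _ y]) auto
  next
    fix x assume "x \<in> {2::nat} \<times> verts G"
    then obtain v where "x = (2, v)" "v \<in> verts G" by auto
    then show "x \<in> D \<or> (\<exists>a \<in> D. \<exists>b \<in> D. (a, x) \<in> S \<and> (x, b) \<in> S)"
      using mid by simp
  qed
  moreover have "card D = (\<Sum>v \<in> verts G. f v)"
  proof -
    have "card D = card (V 1) + 2 * card (V 2)"
      using fin by (simp add: D_def card_Un_disjoint card_cartesian_product disjoint_iff)
    \<comment> \<open>The cardinalities become sums of indicators, whose combination is
      \<open>f v\<close> pointwise since \<open>f v\<close> is 0, 1 or 2.\<close>
    also have "\<dots> = (\<Sum>v \<in> verts G. of_bool (f v = 1) + 2 * of_bool (f v = 2))"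
      by (simp add: V_def sum.distrib Int_def flip: sum_distrib_left)
    also have "\<dots> = (\<Sum>v \<in> verts G. f v)"
      using f by (intro sum.cong) (auto simp: roman_dominating_def)
    finally show ?thesis .
  qed
  moreover have "finite D" using fin by (simp add: D_def)
  ultimately show ?thesis by blast
qed

text \<open>Value 2 on \<open>A\<close> and 1 on the rest of \<open>B\<close> works: a vertex of
  value 0 lies outside \<open>A\<close>, so its \<open>u\<close> in \<open>A\<close> is a true
  neighbour. Stated for an arbitrary \<open>A\<close> so that it applies to either outer
  layer.\<close>

lemma roman_of_near_set:
  assumes "finite (verts G)" "A \<subseteq> verts G" "B \<subseteq> verts G"
    and near: "\<And>v. v \<in> verts G \<Longrightarrow> v \<notin> B \<Longrightarrow> \<exists>u \<in> A. v = u \<or> v \<rightarrow>\<^bsub>G\<^esub> u"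
  shows "\<exists>f. roman_dominating G f \<and> (\<Sum>v \<in> verts G. f v) \<le> 2 * card A + card B"
proof (intro exI conjI)
  define f :: "_ \<Rightarrow> nat" where "f v = (if v \<in> A then 2 else if v \<in> B then 1 else 0)" for v
  show "roman_dominating G f"
    unfolding roman_dominating_def
  proof (intro conjI ballI impI)
    fix v assume "v \<in> verts G" "f v = 0"
    then have "v \<notin> A" "v \<notin> B" by (auto simp: f_def split: if_splits)
    then obtain u where "u \<in> A" "v \<rightarrow>\<^bsub>G\<^esub> u"
      using near \<open>v \<in> verts G\<close> by blast
    then show "\<exists>u \<in> verts G. v \<rightarrow>\<^bsub>G\<^esub> u \<and> f u = 2"
      using assms(2) by (auto simp: f_def)
  qed (simp add: f_def)
  \<comment> \<open>A vertex in both \<open>A\<close> and \<open>B\<close> has value 2 but counts 3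
    on the right, hence only an inequality.\<close>
  have "(\<Sum>v \<in> verts G. f v) \<le> (\<Sum>v \<in> verts G. 2 * of_bool (v \<in> A) + of_bool (v \<in> B))"
    by (intro sum_mono) (auto simp: f_def)
  also have "\<dots> = 2 * card (verts G \<inter> A) + card (verts G \<inter> B)"
    using assms(1) by (simp add: sum.distrib flip: sum_distrib_left)
  also have "\<dots> = 2 * card A + card B"
    using assms(2,3) by (simp add: Int_absorb1)
  finally show "(\<Sum>v \<in> verts G. f v) \<le> 2 * card A + card B" .
qed

lemma roman_of_os_dominating_set:
  assumes "graph G" and D: "os_dominating_set (layer_elts 3 G) (layer_order 3 G) D"
  shows "\<exists>f. roman_dominating G f \<and> (\<Sum>v \<in> verts G. f v) \<le> card D"
proof -
  interpret graph G by fact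
  define L where "L l = {v. (l, v) \<in> D}" for l
  have sub: "D \<subseteq> layer_elts 3 G"
    using D by (simp add: os_dominating_set_def dominating_set_def Comp_def)
  then have L_sub: "L l \<subseteq> verts G" for l by (auto simp: L_def layer_elts_def)
  have fin: "finite (L l)" for l using L_sub finite_verts by (rule finite_subset)
  have near: "(\<exists>u \<in> L 1. v = u \<or> v \<rightarrow>\<^bsub>G\<^esub> u) \<and> (\<exists>u \<in> L 3. v = u \<or> v \<rightarrow>\<^bsub>G\<^esub> u)"
    if v: "v \<in> verts G" "v \<notin> L 2" for v
  proof -
    from v D obtain a b where ab: "a \<in> D" "b \<in> D"
        "(a, (2, v)) \<in> strict_rel (layer_order 3 G)" "((2, v), b) \<in> strict_rel (layer_order 3 G)"
      by (auto simp: os_dominating_set_def Mid_layer_order_3 L_def)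
    \<comment> \<open>Only levels 1 to 3 exist, so strictly below or above level 2 leaves one choice
      each.\<close>
    moreover have "fst a = 1" "fst b = 3"
      using strict_layer_order_level[OF ab(3)] strict_layer_order_level[OF ab(4)] ab(1,2) sub
      by (auto simp: layer_elts_def)
    ultimately obtain i j where ij: "i \<in> L 1" "j \<in> L 3"
        "((1, i), (2, v)) \<in> strict_rel (layer_order 3 G)"
        "((2, v), (3, j)) \<in> strict_rel (layer_order 3 G)"
      by (cases a; cases b) (auto simp: L_def)
    have "i = v \<or> i \<rightarrow>\<^bsub>G\<^esub> v" "v = j \<or> v \<rightarrow>\<^bsub>G\<^esub> j"
      using strict_layer_order_SucD[of 1 i v 3 G] strict_layer_order_SucD[of 2 v j 3 G] ij
      by (auto simp: eval_nat_numeral)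
    \<comment> \<open>The cover below \<open>(2, v)\<close> gives an arc from \<open>i\<close> to
      \<open>v\<close>; symmetry of the graph reverses it.\<close>
    then show ?thesis using ij arcs_ends_symmetric[OF sym_arcs] by blast
  qed
  have "D = {1} \<times> L 1 \<union> {2} \<times> L 2 \<union> {3} \<times> L 3"
  proof (intro set_eqI iffI)
    fix x assume "x \<in> D"
    moreover from this sub have "fst x = 1 \<or> fst x = 2 \<or> fst x = 3"
      by (auto simp: layer_elts_def)
    ultimately show "x \<in> {1} \<times> L 1 \<union> {2} \<times> L 2 \<union> {3} \<times> L 3"
      by (cases x) (auto simp: L_def)
  qed (auto simp: L_def)
  then have "card D = card ({1::nat} \<times> L 1 \<union> {2} \<times> L 2 \<union> {3} \<times> L 3)"
    by simp
  also have "\<dots> = card (L 1) + card (L 2) + card (L 3)"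
    using fin by (subst card_Un_disjoint; auto simp: card_Un_disjoint card_cartesian_product disjoint_iff)+
  finally have card_D: "card D = card (L 1) + card (L 2) + card (L 3)" .
  show ?thesis
  proof (cases "card (L 1) \<le> card (L 3)")
    case True
    have "\<exists>f. roman_dominating G f \<and> (\<Sum>v \<in> verts G. f v) \<le> 2 * card (L 1) + card (L 2)"
      using near by (intro roman_of_near_set finite_verts L_sub) simp
    then show ?thesis using True card_D by (elim exE) (intro exI, auto)
  next
    case False
    have "\<exists>f. roman_dominating G f \<and> (\<Sum>v \<in> verts G. f v) \<le> 2 * card (L 3) + card (L 2)"
      using near by (intro roman_of_near_set finite_verts L_sub) simp
    then show ?thesis using False card_D by (elim exE) (intro exI, auto)
  qed
qed

theorem theorem12:
  fixes G :: "('a, 'b) pre_digraph"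
  assumes "graph G" and "connected G" and "card (verts G) \<ge> 2"
  shows "gamma_os (layer_elts 3 G) (layer_order 3 G) = gamma_R G"
proof -
  \<comment> \<open>Supplies the attained value that \<open>Least_nat_eqI\<close> asks for. Roman
    weights therefore play the role of \<open>P\<close>, and the equation is applied in
    reverse.\<close>
  have "roman_dominating G (\<lambda>_. 1)" by (simp add: roman_dominating_def)
  then show ?thesis
    unfolding gamma_R_def gamma_os_def
    using os_dominating_set_of_roman[OF assms(1)] roman_of_os_dominating_set[OF assms(1)]
    by (intro Least_nat_eqI[symmetric]) blast+
qed

end
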